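(* Let $I\subset\mathbb{N}$, let $X_i$ ($i\in I$) be random variables following a known distribution, with PDFs $f_{X_i}$, and let $Y$ be a random variable whose PDF is $$f_Y(t)=\sum_{i\in I}A_i f_{X_i}(t),$$ where $A_i\in\mathbb{R}$ and $\sum_{i\in I}A_i=1$. Then the moment of order $k$ of $Y$ is $$E[Y^k]=\sum_{i\in I}A_iE[X_i^k].$$
   Context: "PDF" means probability density function in the continuous case and probability mass function in the discrete case; both cases are covered. The moment of order $k$ of $X$ is $E[X^k]=\int_{-\infty}^{+\infty}x^kf_X(x)\,dx$ in the continuous case and $E[X^k]=\sum_jx_j^kf_X(x_j)$ in the discrete case. The coefficients $A_i$ may be negative.
   Formalization: The moments of order k of the X_i are assumed to exist and, since the claim can fail for infinite I with signed A_i, the sum over I of |A_i| E[|X_i|^k] is assumed finite (automatic for finite I); sums over infinite I are taken in increasing order of i. *)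

theory Defs
  imports "HOL-Probability.Probability"
begin

definition has_density :: "'a measure \<Rightarrow> ('a \<Rightarrow> real) \<Rightarrow> (real \<Rightarrow> real) \<Rightarrow> bool" where
  "has_density M X f \<longleftrightarrow> (\<forall>x. 0 \<le> f x) \<and> distributed M lborel X (\<lambda>x. ennreal (f x))"

(* The values x_j are the elements of the countable set S; f is 0 at every other point. *)
definition has_pmf :: "'a measure \<Rightarrow> ('a \<Rightarrow> real) \<Rightarrow> (real \<Rightarrow> real) \<Rightarrow> bool" where
  "has_pmf M X f \<longleftrightarrow>
     X \<in> borel_measurable M \<and>
     (\<exists>S. countable S \<and> (AE \<omega> in M. X \<omega> \<in> S)) \<and>
     (\<forall>x. f x = measure M {\<omega> \<in> space M. X \<omega> = x})"

definition moment :: "'a measure \<Rightarrow> ('a \<Rightarrow> real) \<Rightarrow> nat \<Rightarrow> real" where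
  "moment M X k = prob_space.expectation M (\<lambda>\<omega>. X \<omega> ^ k)"

(* The integral is 0 for non-integrable functions, so existence is a separate condition. *)
definition moment_exists :: "'a measure \<Rightarrow> ('a \<Rightarrow> real) \<Rightarrow> nat \<Rightarrow> bool" where
  "moment_exists M X k \<longleftrightarrow> integrable M (\<lambda>\<omega>. X \<omega> ^ k)"

lemma moment_density:
  assumes "has_density M X f"
  shows "moment M X k = (LINT x|lborel. x ^ k * f x)"
proof -
  have "(LINT x|lborel. f x * x ^ k) = (LINT \<omega>|M. X \<omega> ^ k)"
    using assms by (intro distributed_integral) (auto simp: has_density_def)
  then show ?thesis
    by (simp add: moment_def mult.commute)
qed

lemma moment_pmf:
  assumes "prob_space M" and X: "has_pmf M X f" and ex: "moment_exists M X k"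
  shows "moment M X k = (\<Sum>\<^sub>\<infinity>x. x ^ k * f x)"
proof -
  interpret prob_space M by fact
  have Xm[measurable]: "X \<in> borel_measurable M"
    and f: "\<And>x. f x = measure M {\<omega> \<in> space M. X \<omega> = x}"
    using X by (auto simp: has_pmf_def)
  obtain S where S: "countable S" and AES: "AE \<omega> in M. X \<omega> \<in> S"
    using X by (auto simp: has_pmf_def)
  have "S \<noteq> {}"
    using AES by auto
  then obtain s where s: "s \<in> S" by auto
  have [measurable]: "S \<in> sets borel"
    using S by (rule sets.countable[rotated]) auto
  define X' where "X' \<omega> = (if X \<omega> \<in> S then X \<omega> else s)" for \<omega>
  have [measurable]: "X' \<in> borel_measurable M"
    unfolding X'_def by measurable
  have AEX': "AE \<omega> in M. X' \<omega> = X \<omega>"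
    using AES by eventually_elim (simp add: X'_def)
  have X'S[measurable]: "X' \<in> measurable M (count_space S)"
    using S s by (subst measurable_count_space_eq_countable) (auto simp: X'_def)
  have D: "distr M (count_space S) X' = density (count_space S) (\<lambda>x. ennreal (f x))"
  proof (rule measure_eqI_countable[OF _ _ S])
    fix a assume a: "a \<in> S"
    have "emeasure M (X' -` {a} \<inter> space M) = emeasure M {\<omega> \<in> space M. X \<omega> = a}"
      using AEX' by (intro emeasure_eq_AE) auto
    then show "emeasure (distr M (count_space S) X') {a} =
        emeasure (density (count_space S) (\<lambda>x. ennreal (f x))) {a}"
      using a by (simp add: emeasure_distr emeasure_density f emeasure_eq_measure
          nn_integral_count_space_indicator[symmetric] nn_integral_count_space_finite)
  qed simp_all
  have f_nonneg: "0 \<le> f x" for x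
    by (simp add: f)
  have f0: "f x = 0" if "x \<notin> S" for x
  proof -
    have "AE \<omega> in M. X \<omega> \<noteq> x"
      using AES that by (auto elim!: eventually_mono)
    then show ?thesis
      unfolding f by (subst prob_eq_0) auto
  qed
  have "integrable M (\<lambda>\<omega>. X' \<omega> ^ k)"
    using ex AEX' unfolding moment_exists_def
    by (subst integrable_cong_AE[where g = "\<lambda>\<omega>. X \<omega> ^ k"]) auto
  then have "integrable (distr M (count_space S) X') (\<lambda>x. x ^ k)"
    by (subst integrable_distr_eq) auto
  then have abs: "Infinite_Set_Sum.abs_summable_on (\<lambda>x. f x * x ^ k) S"
    unfolding D Infinite_Set_Sum.abs_summable_on_def
    by (subst (asm) integrable_density) (auto simp: f_nonneg)
  have "moment M X k = (LINT \<omega>|M. X' \<omega> ^ k)"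
    unfolding moment_def using AEX' by (intro integral_cong_AE) auto
  also have "\<dots> = (LINT x|distr M (count_space S) X'. x ^ k)"
    by (subst integral_distr) auto
  also have "\<dots> = infsetsum (\<lambda>x. f x * x ^ k) S"
    unfolding D infsetsum_def by (subst integral_density) (auto simp: f_nonneg)
  also have "\<dots> = (\<Sum>\<^sub>\<infinity>x\<in>S. f x * x ^ k)"
    by (rule infsetsum_infsum[OF abs])
  also have "\<dots> = (\<Sum>\<^sub>\<infinity>x. x ^ k * f x)"
    by (rule infsum_cong_neutral) (auto simp: f0)
  finally show ?thesis .
qed

end

theory Submission
  imports Defs
begin

text \<open>Both cases are instances of one: the discrete laws involved all have a density with respect
  to the counting measure on a common countable set of values, pushed forward to the real line.
  For laws with densities with respect to a fixed measure, the claim is the interchange of sum and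
  integral. This is justified by Tonelli's theorem, since the integrals of
  \<open>\<bar>A\<^sub>i f\<^sub>i(x) x\<^sup>k\<bar>\<close> are summable by assumption.\<close>

text \<open>For nonnegative terms, sum and integral always commute in the extended reals. The total
  integral is finite here, so the summed integrand is infinite only on a null set.\<close>

lemma summable_integral_imp_AE_summable:
  fixes g :: "nat \<Rightarrow> 'a \<Rightarrow> real"
  assumes g: "\<And>i. integrable M (g i)" and sum: "summable (\<lambda>i. LINT x|M. \<bar>g i x\<bar>)"
  shows "AE x in M. summable (\<lambda>i. \<bar>g i x\<bar>)"
proof -
  have [measurable]: "g i \<in> borel_measurable M" for i
    using g by auto
  have "(\<integral>\<^sup>+x. (\<Sum>i. ennreal \<bar>g i x\<bar>) \<partial>M) = (\<Sum>i. \<integral>\<^sup>+x. ennreal \<bar>g i x\<bar> \<partial>M)"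
    by (rule nn_integral_suminf) simp
  also have "\<dots> = (\<Sum>i. ennreal (LINT x|M. \<bar>g i x\<bar>))"
    using g by (intro suminf_cong nn_integral_eq_integral) auto
  also have "\<dots> \<noteq> \<infinity>"
    using sum by (simp add: suminf_ennreal2)
  finally have "AE x in M. (\<Sum>i. ennreal \<bar>g i x\<bar>) \<noteq> \<infinity>"
    by (intro nn_integral_PInf_AE) auto
  then show ?thesis
    by eventually_elim (auto intro: summable_suminf_not_top)
qed

text \<open>Dominated convergence for series, phrased with a prescribed pointwise limit
  \<open>h\<close> instead of \<open>suminf\<close>, so that integrability is obtained for
  \<open>h\<close> itself.\<close>

lemma sums_integral_Tonelli:
  fixes g :: "nat \<Rightarrow> 'a \<Rightarrow> real"
  assumes g: "\<And>i. integrable M (g i)" and sum: "summable (\<lambda>i. LINT x|M. \<bar>g i x\<bar>)"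
    and h: "\<And>x. x \<in> space M \<Longrightarrow> (\<lambda>i. g i x) sums h x"
  shows "integrable M h" and "(\<lambda>i. LINT x|M. g i x) sums (LINT x|M. h x)"
proof -
  have AE: "AE x in M. summable (\<lambda>i. norm (g i x))"
    using summable_integral_imp_AE_summable[OF g sum] by simp
  have sum': "summable (\<lambda>i. LINT x|M. norm (g i x))"
    using sum by simp
  have h': "(\<Sum>i. g i x) = h x" if "x \<in> space M" for x
    using h[OF that] by (rule sums_unique[symmetric])
  show "integrable M h"
    using integrable_suminf[OF g AE sum'] by (simp add: h' cong: Bochner_Integration.integrable_cong)
  show "(\<lambda>i. LINT x|M. g i x) sums (LINT x|M. h x)"
    using sums_integral[OF g AE sum'] by (simp add: h' cong: Bochner_Integration.integral_cong)
qed

text \<open>The reference measure is arbitrary on the Borel sets, which makes the lemma applicable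
  both to \<open>lborel\<close> and to a transported counting measure.\<close>

lemma sums_moment_distributed:
  fixes \<mu> :: "real measure" and A :: "nat \<Rightarrow> real"
  assumes sets: "sets \<mu> = sets borel"
    and X: "\<And>i. i \<in> I \<Longrightarrow> distributed (M i) \<mu> (X i) (\<lambda>x. ennreal (f i x))"
    and f: "\<And>i x. i \<in> I \<Longrightarrow> 0 \<le> f i x"
    and Y: "distributed N \<mu> Y (\<lambda>x. ennreal (fY x))"
    and fY: "\<And>x. 0 \<le> fY x"
    and mix: "\<And>t. (\<lambda>i. if i \<in> I then A i * f i t else 0) sums fY t"
    and ex: "\<And>i. i \<in> I \<Longrightarrow> moment_exists (M i) (X i) k"
    and sum: "summable (\<lambda>i. if i \<in> I then \<bar>A i\<bar> * moment (M i) (\<lambda>\<omega>. \<bar>X i \<omega>\<bar>) k else 0)"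
  shows "moment_exists N Y k"
    and "(\<lambda>i. if i \<in> I then A i * moment (M i) (X i) k else 0) sums moment N Y k"
proof -
  \<comment> \<open>Terms of the integrand of the moment of \<open>Y\<close>, padded with 0 off
    \<open>I\<close> so that the series runs over all naturals.\<close>
  define g where "g = (\<lambda>i x. if i \<in> I then A i * (f i x * x ^ k) else 0)"
  have [measurable_cong]: "sets \<mu> = sets borel" by fact
  have pow: "(\<lambda>x. x ^ k) \<in> borel_measurable \<mu>" and abs_pow: "(\<lambda>x. \<bar>x\<bar> ^ k) \<in> borel_measurable \<mu>"
    by measurable
  have int: "integrable \<mu> (g i)" for i
  proof (cases "i \<in> I")
    case True
    then have "integrable \<mu> (\<lambda>x. f i x * x ^ k)"
      using ex[OF True] f distributed_integrable[OF X[OF True] pow] by (auto simp: moment_exists_def)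
    then show ?thesis
      using True by (auto simp: g_def)
  qed (simp add: g_def)
  \<comment> \<open>Since \<open>f i\<close> is nonnegative, the absolute value falls only on
    \<open>A i\<close> and on the power. The L1 norms of the terms are thus exactly the weighted
    absolute moments assumed summable.\<close>
  have "(LINT x|\<mu>. \<bar>g i x\<bar>) = (if i \<in> I then \<bar>A i\<bar> * moment (M i) (\<lambda>\<omega>. \<bar>X i \<omega>\<bar>) k else 0)" for i
    using distributed_integral[OF X abs_pow] f
    by (cases "i \<in> I") (simp_all add: g_def moment_def abs_mult power_abs)
  then have sum': "summable (\<lambda>i. LINT x|\<mu>. \<bar>g i x\<bar>)"
    using sum by simp
  have "(\<lambda>i. g i x) sums (fY x * x ^ k)" for x
  proof -
    have "g i x = (if i \<in> I then A i * f i x else 0) * x ^ k" for i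
      by (simp add: g_def)
    then show ?thesis
      using sums_mult2[OF mix, of x "x ^ k"] by simp
  qed
  note * = sums_integral_Tonelli[OF int sum' this]
  show "moment_exists N Y k"
    using *(1) distributed_integrable[OF Y pow] fY by (simp add: moment_exists_def)
  have "(LINT x|\<mu>. g i x) = (if i \<in> I then A i * moment (M i) (X i) k else 0)" for i
    using distributed_integral[OF X pow] f by (cases "i \<in> I") (simp_all add: g_def moment_def)
  moreover have "(LINT x|\<mu>. fY x * x ^ k) = moment N Y k"
    using distributed_integral[OF Y pow] fY by (simp add: moment_def)
  ultimately show "(\<lambda>i. if i \<in> I then A i * moment (M i) (X i) k else 0) sums moment N Y k"
    using *(2) by simp
qed

text \<open>\<open>X\<close> may leave \<open>S\<close> on a null set, so it need not map into the
  space of \<open>count_space S\<close>; pushing the counting measure forward along the identity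
  gives a measure on all Borel sets of the line. \<open>S\<close> is any countable set carrying
  \<open>X\<close>, so several variables can share one.\<close>

lemma has_pmf_distributed:
  assumes "prob_space M" and X: "has_pmf M X f"
    and S: "countable S" and AES: "AE \<omega> in M. X \<omega> \<in> S"
  shows "distributed M (distr (count_space S) borel (\<lambda>x. x)) X (\<lambda>x. ennreal (f x))"
proof -
  interpret prob_space M by fact
  let ?\<mu> = "distr (count_space S) borel (\<lambda>x. x)"
  have [measurable]: "X \<in> borel_measurable M"
    and f: "f x = measure M {\<omega> \<in> space M. X \<omega> = x}" for x
    using X by (auto simp: has_pmf_def)
  have [measurable]: "S \<in> sets borel"
    by (rule sets.countable) (auto intro: S)
  have f0: "f x = 0" if "x \<notin> S" for x
  proof -
    have "AE \<omega> in M. X \<omega> \<noteq> x"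
      using AES that by (auto elim!: eventually_mono)
    then show ?thesis
      unfolding f by (subst prob_eq_0) auto
  qed
  \<comment> \<open>\<open>f\<close> differs from the zero function only on the countable set
    \<open>S\<close>.\<close>
  have [measurable]: "f \<in> borel_measurable borel"
    by (rule measurable_discrete_difference[where f = "\<lambda>_. 0" and X = S]) (auto simp: S f0)
  have "distr M ?\<mu> X = density ?\<mu> (\<lambda>x. ennreal (f x))"
  proof (rule measure_eqI)
    fix B assume "B \<in> sets (distr M ?\<mu> X)"
    then have [measurable]: "B \<in> sets borel" by simp
    have "emeasure (distr M ?\<mu> X) B = emeasure M {\<omega> \<in> space M. X \<omega> \<in> B}"
      by (subst emeasure_distr) (auto simp: vimage_def Int_def conj_commute)
    \<comment> \<open>Discarding a null event leaves a countable disjoint union of fibres of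
      \<open>X\<close>, whose probabilities are the values of \<open>f\<close>.\<close>
    also have "\<dots> = emeasure M {\<omega> \<in> space M. X \<omega> \<in> B \<inter> S}"
      using AES by (intro emeasure_eq_AE) auto
    also have "{\<omega> \<in> space M. X \<omega> \<in> B \<inter> S} = (\<Union>x\<in>B \<inter> S. {\<omega> \<in> space M. X \<omega> = x})"
      by auto
    also have "emeasure M \<dots> = (\<integral>\<^sup>+x. emeasure M {\<omega> \<in> space M. X \<omega> = x} \<partial>count_space (B \<inter> S))"
      using S by (intro emeasure_UN_countable) (auto simp: disjoint_family_on_def)
    also have "\<dots> = (\<integral>\<^sup>+x. ennreal (f x) \<partial>count_space (B \<inter> S))"
      by (simp add: f emeasure_eq_measure)
    also have "\<dots> = (\<integral>\<^sup>+x. ennreal (f x) * indicator B x \<partial>count_space S)"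
      by (simp add: nn_integral_count_space_indicator indicator_inter_arith mult_ac)
    also have "\<dots> = emeasure (density ?\<mu> (\<lambda>x. ennreal (f x))) B"
      by (subst emeasure_density) (auto simp: nn_integral_distr)
    finally show "emeasure (distr M ?\<mu> X) B = emeasure (density ?\<mu> (\<lambda>x. ennreal (f x))) B" .
  qed simp
  then show ?thesis
    by (simp add: distributed_def)
qed

theorem theorem5:
  fixes I :: "nat set"
    and M :: "nat \<Rightarrow> 'a measure" and X :: "nat \<Rightarrow> 'a \<Rightarrow> real" and f :: "nat \<Rightarrow> real \<Rightarrow> real"
    and N :: "'b measure" and Y :: "'b \<Rightarrow> real" and fY :: "real \<Rightarrow> real"
    and A :: "nat \<Rightarrow> real" and k :: nat
  assumes "\<And>i. i \<in> I \<Longrightarrow> prob_space (M i)"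
    and "prob_space N"
    and "(\<forall>i\<in>I. has_density (M i) (X i) (f i)) \<and> has_density N Y fY \<or>
         (\<forall>i\<in>I. has_pmf (M i) (X i) (f i)) \<and> has_pmf N Y fY"
    and "\<And>t. (\<lambda>i. if i \<in> I then A i * f i t else 0) sums fY t"
    and "(\<lambda>i. if i \<in> I then A i else 0) sums 1"
    and "\<And>i. i \<in> I \<Longrightarrow> moment_exists (M i) (X i) k"
    and "summable (\<lambda>i. if i \<in> I then \<bar>A i\<bar> * moment (M i) (\<lambda>\<omega>. \<bar>X i \<omega>\<bar>) k else 0)"
  shows "moment_exists N Y k \<and>
         (\<lambda>i. if i \<in> I then A i * moment (M i) (X i) k else 0) sums moment N Y k"
proof -
  note mix = assms(4) and ex = assms(6) and sum = assms(7)
  from assms(3) show ?thesis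
  proof
    assume "(\<forall>i\<in>I. has_density (M i) (X i) (f i)) \<and> has_density N Y fY"
    then show ?thesis
      using sums_moment_distributed[of lborel I M X f N Y fY A k] mix ex sum
      by (simp add: has_density_def)
  next
    assume pmf: "(\<forall>i\<in>I. has_pmf (M i) (X i) (f i)) \<and> has_pmf N Y fY"
    then have "\<forall>i\<in>I. \<exists>S. countable S \<and> (AE \<omega> in M i. X i \<omega> \<in> S)"
      by (auto simp: has_pmf_def)
    then obtain S where S: "\<And>i. i \<in> I \<Longrightarrow> countable (S i)"
        "\<And>i. i \<in> I \<Longrightarrow> AE \<omega> in M i. X i \<omega> \<in> S i"
      by metis
    obtain T where T: "countable T" "AE \<omega> in N. Y \<omega> \<in> T"
      using pmf by (auto simp: has_pmf_def)
    \<comment> \<open>One set of values for all the laws at once: it is countable because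
      \<open>I\<close> consists of naturals, and it contains \<open>T\<close> so that it carries
      \<open>Y\<close> as well.\<close>
    define U where "U = T \<union> (\<Union>i\<in>I. S i)"
    have U: "countable U"
      using S(1) T(1) by (auto simp: U_def)
    have "distributed (M i) (distr (count_space U) borel (\<lambda>x. x)) (X i) (\<lambda>x. ennreal (f i x))"
      if "i \<in> I" for i
      using that pmf S(2)[OF that] assms(1)
      by (intro has_pmf_distributed[OF _ _ U]) (auto simp: U_def elim!: eventually_mono)
    moreover have "distributed N (distr (count_space U) borel (\<lambda>x. x)) Y (\<lambda>x. ennreal (fY x))"
      using pmf T(2) assms(2)
      by (intro has_pmf_distributed[OF _ _ U]) (auto simp: U_def elim!: eventually_mono)
    moreover have "0 \<le> f i x" if "i \<in> I" for i x
      using that pmf by (simp add: has_pmf_def)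
    moreover have "0 \<le> fY x" for x
      using pmf by (simp add: has_pmf_def)
    ultimately show ?thesis
      using sums_moment_distributed[of "distr (count_space U) borel (\<lambda>x. x)" I M X f N Y fY A k]
        mix ex sum by simp
  qed
qed

end
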